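(* The transition rate $q_{\infty\infty}=\lim_{t\searrow 0}\frac{p_{\infty\infty}(t)-1}{t}$ satisfies $$q_{\infty\infty}=-\infty,$$ i.e. $\frac{p_{\infty\infty}(t)-1}{t}$ diverges to minus infinity as $t\searrow 0$.
   Context: Let $\mathbb S$ be a countably infinite set, $\infty$ a symbol not in $\mathbb S$, and $\bar{\mathbb S}=\mathbb S\cup\{\infty\}$. The parameters are strictly positive reals $\{\gamma_x,\lambda_x:x\in\mathbb S\}$ and a constant $c\ge 0$, with $\sum_{x\in\mathbb S}\lambda_x=\infty$ and $\sum_{x\in\mathbb S}\lambda_x\gamma_x<\infty$; set $\gamma_\infty=0$. On a probability space $(\Omega,\mathcal F,\mathbb P)$ let the following be independent: a family $\{N_x:x\in\mathbb S\}$ of independent Poisson processes on $\mathbb R^+$, $N_x$ of rate $\lambda_x$ with marks $0<\sigma^x_1<\sigma^x_2<\cdots$ ($N_x(t)$ is the number of marks in $[0,t]$), and a family $\{T_0\}\cup\{T^x_n:n\ge 1,x\in\mathbb S\}$ of i.i.d. exponential random variables of rate $1$. Clock process: for $y\in\bar{\mathbb S}$, $t\ge 0$, $\Gamma^y(t)=\gamma_yT_0+\sum_{z\in\mathbb S}\sum_{i=1}^{N_z(t)}\gamma_zT^z_i+ct$ (empty sums are $0$), and $\Gamma^y(s-)$ denotes its left limit at $s$. K process with initial state $y\in\bar{\mathbb S}$: $X^y(t)=y$ if $t<\gamma_yT_0$; $X^y(t)=x$ (with $x\in\mathbb S$) if $t\in\bigcup_{i\ge 1}[\Gamma^y(\sigma^x_i-),\Gamma^y(\sigma^x_i))$;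 $X^y(t)=\infty$ otherwise. Transition functions: $p_{xy}(t)=\mathbb P(X^x(t)=y)$ for $x,y\in\bar{\mathbb S}$, $t\ge 0$. *)

theory Defs
  imports "HOL-Probability.Probability"
begin

text \<open>
  The countably infinite set of stable states is a type \<open>'s\<close> of class \<open>countable\<close> (assumed infinite
  in the theorem); the extended state space is \<open>'s option\<close>, with \<open>None\<close> for the extra point
  \<open>\<infinity>\<close>.
  Marks \<open>\<sigma> x i\<close> and exponential variables \<open>T x i\<close> are indexed by \<open>i \<ge> 1\<close>; their values at \<open>i = 0\<close>
  are never used.
\<close>

text \<open>Number of marks in \<open>[0, t]\<close>; the lower bound is implicit because marks are positive.\<close>

definition counting :: "(nat \<Rightarrow> 'w \<Rightarrow> real) \<Rightarrow> real \<Rightarrow> 'w \<Rightarrow> nat" where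
  "counting \<sigma> t \<omega> = card {i. 1 \<le> i \<and> \<sigma> i \<omega> \<le> t}"

definition poisson_process :: "'w measure \<Rightarrow> real \<Rightarrow> (nat \<Rightarrow> 'w \<Rightarrow> real) \<Rightarrow> bool" where
  "poisson_process M r \<sigma> \<longleftrightarrow>
     (\<forall>i\<ge>1. \<sigma> i \<in> borel_measurable M) \<and>
     (\<forall>\<omega>\<in>space M. 0 < \<sigma> 1 \<omega> \<and> (\<forall>i\<ge>1. \<sigma> i \<omega> < \<sigma> (Suc i) \<omega>) \<and>
        (\<forall>t. finite {i. 1 \<le> i \<and> \<sigma> i \<omega> \<le> t})) \<and>
     (\<forall>s t. 0 \<le> s \<and> s < t \<longrightarrow>
        distr M (count_space UNIV) (\<lambda>\<omega>. counting \<sigma> t \<omega> - counting \<sigma> s \<omega>)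
          = measure_pmf (poisson_pmf (r * (t - s)))) \<and>
     (\<forall>(n::nat) (t :: nat \<Rightarrow> real). 0 \<le> t 0 \<and> (\<forall>k<n. t k \<le> t (Suc k)) \<longrightarrow>
        prob_space.indep_vars M (\<lambda>_. count_space UNIV)
          (\<lambda>k \<omega>. counting \<sigma> (t (Suc k)) \<omega> - counting \<sigma> (t k) \<omega>) {..<n})"

abbreviation path_space :: "(real \<Rightarrow> nat) measure" where
  "path_space \<equiv> PiM {0..} (\<lambda>_. count_space UNIV)"

definition path :: "(nat \<Rightarrow> 'w \<Rightarrow> real) \<Rightarrow> 'w \<Rightarrow> real \<Rightarrow> nat" where
  "path \<sigma> \<omega> = (\<lambda>t\<in>{0..}. counting \<sigma> t \<omega>)"

text \<open>The family \<open>{T\<^sub>0} \<union> {T x n | n \<ge> 1}\<close> as a single indexed family.\<close>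

abbreviation exp_index :: "('s \<times> nat) option set" where
  "exp_index \<equiv> insert None (Some ` (UNIV \<times> {1..}))"

definition exp_family ::
    "('w \<Rightarrow> real) \<Rightarrow> ('s \<Rightarrow> nat \<Rightarrow> 'w \<Rightarrow> real) \<Rightarrow> ('s \<times> nat) option \<Rightarrow> 'w \<Rightarrow> real" where
  "exp_family T0 T k = (case k of None \<Rightarrow> T0 | Some (x, n) \<Rightarrow> T x n)"

text \<open>Mutual independence of all the processes and all the exponential variables: independence
  within each family, and independence of the two sigma-algebras that the families generate.\<close>

definition independent_inputs ::
    "'w measure \<Rightarrow> ('s \<Rightarrow> nat \<Rightarrow> 'w \<Rightarrow> real) \<Rightarrow> ('w \<Rightarrow> real) \<Rightarrow> ('s \<Rightarrow> nat \<Rightarrow> 'w \<Rightarrow> real) \<Rightarrow> bool" where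
  "independent_inputs M \<sigma> T0 T \<longleftrightarrow>
     prob_space.indep_vars M (\<lambda>_. path_space) (\<lambda>x. path (\<sigma> x)) UNIV \<and>
     prob_space.indep_vars M (\<lambda>_. borel) (exp_family T0 T) exp_index \<and>
     prob_space.indep_set M
       (sets (vimage_algebra (space M) (\<lambda>\<omega> x. path (\<sigma> x) \<omega>) (PiM UNIV (\<lambda>_. path_space))))
       (sets (vimage_algebra (space M) (\<lambda>\<omega>. \<lambda>k\<in>exp_index. exp_family T0 T k \<omega>)
          (PiM exp_index (\<lambda>_. borel))))"

definition ext_gamma :: "('s \<Rightarrow> real) \<Rightarrow> 's option \<Rightarrow> real" where
  "ext_gamma \<gamma> y = (case y of None \<Rightarrow> 0 | Some x \<Rightarrow> \<gamma> x)"

text \<open>The clock process is \<open>ennreal\<close>-valued because the series is finite only almost surely.\<close>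

definition clock ::
    "('s \<Rightarrow> real) \<Rightarrow> real \<Rightarrow> ('s \<Rightarrow> nat \<Rightarrow> 'w \<Rightarrow> real) \<Rightarrow> ('w \<Rightarrow> real) \<Rightarrow> ('s \<Rightarrow> nat \<Rightarrow> 'w \<Rightarrow> real)
      \<Rightarrow> 's option \<Rightarrow> real \<Rightarrow> 'w \<Rightarrow> ennreal" where
  "clock \<gamma> c \<sigma> T0 T y t \<omega> =
     ennreal (ext_gamma \<gamma> y * T0 \<omega>)
     + (\<Sum>\<^sub>\<infinity>z\<in>UNIV. \<Sum>i=1..counting (\<sigma> z) t \<omega>. ennreal (\<gamma> z * T z i \<omega>))
     + ennreal (c * t)"

definition in_sojourn ::
    "('s \<Rightarrow> real) \<Rightarrow> real \<Rightarrow> ('s \<Rightarrow> nat \<Rightarrow> 'w \<Rightarrow> real) \<Rightarrow> ('w \<Rightarrow> real) \<Rightarrow> ('s \<Rightarrow> nat \<Rightarrow> 'w \<Rightarrow> real)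
      \<Rightarrow> 's option \<Rightarrow> real \<Rightarrow> 'w \<Rightarrow> 's \<Rightarrow> bool" where
  "in_sojourn \<gamma> c \<sigma> T0 T y t \<omega> x \<longleftrightarrow>
     ennreal t \<in> (\<Union>i\<in>{1..}. {Lim (at_left (\<sigma> x i \<omega>)) (\<lambda>s. clock \<gamma> c \<sigma> T0 T y s \<omega>)
                              ..< clock \<gamma> c \<sigma> T0 T y (\<sigma> x i \<omega>) \<omega>})"

text \<open>
  The state \<open>x\<close> with \<open>in_sojourn \<dots> x\<close> is unique unless two of the Poisson processes have a common
  mark, a null event; there the state that comes first in the enumeration of \<open>'s\<close> is taken. Unlike
  \<open>THE\<close>, this choice keeps the process measurable.
\<close>

definition K_process ::
    "('s::countable \<Rightarrow> real) \<Rightarrow> real \<Rightarrow> ('s \<Rightarrow> nat \<Rightarrow> 'w \<Rightarrow> real) \<Rightarrow> ('w \<Rightarrow> real)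
      \<Rightarrow> ('s \<Rightarrow> nat \<Rightarrow> 'w \<Rightarrow> real) \<Rightarrow> 's option \<Rightarrow> real \<Rightarrow> 'w \<Rightarrow> 's option" where
  "K_process \<gamma> c \<sigma> T0 T y t \<omega> =
     (if t < ext_gamma \<gamma> y * T0 \<omega> then y
      else if \<exists>x. in_sojourn \<gamma> c \<sigma> T0 T y t \<omega> x
        then Some (arg_min to_nat (in_sojourn \<gamma> c \<sigma> T0 T y t \<omega>))
      else None)"

definition trans_prob ::
    "'w measure \<Rightarrow> ('s::countable \<Rightarrow> real) \<Rightarrow> real \<Rightarrow> ('s \<Rightarrow> nat \<Rightarrow> 'w \<Rightarrow> real) \<Rightarrow> ('w \<Rightarrow> real)
      \<Rightarrow> ('s \<Rightarrow> nat \<Rightarrow> 'w \<Rightarrow> real) \<Rightarrow> 's option \<Rightarrow> 's option \<Rightarrow> real \<Rightarrow> real" where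
  "trans_prob M \<gamma> c \<sigma> T0 T x y t =
     measure M {\<omega> \<in> space M. K_process \<gamma> c \<sigma> T0 T x t \<omega> = y}"

end

theory Submission
  imports Defs
begin

text \<open>
  A process started at \<open>\<infinity>\<close> leaves it at an infinite rate because it can be caught in a sojourn at
  any state of an arbitrarily large finite set \<open>F\<close>, and the total mark rate
  \<open>\<Lambda> = \<Sum>x\<in>F. rate x\<close> is unbounded over such \<open>F\<close>, since the rates are not summable.

  Fix \<open>F\<close> and a small real time \<open>t\<close>, and let \<open>s = \<delta> t\<close>, where \<open>\<delta>\<close> depends only on \<open>c\<close> and on the
  finite number \<open>m = \<Sum>x. rate x * \<gamma> x\<close>. Consider three events. First, \<open>D\<close>: some state of \<open>F\<close> has
  a mark in \<open>[0, s]\<close>. Second: for every \<open>x\<close> in \<open>F\<close> the first sojourn at \<open>x\<close>, of length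
  \<open>\<gamma> x * T x 1\<close>, is longer than \<open>t\<close>. Third: the marks outside \<open>F\<close> and the drift \<open>c\<close> bring the clock
  by time \<open>s\<close> to at most \<open>t\<close>. If all three occur, then up to the earliest mark of \<open>F\<close> the clock only
  collects contributions from outside \<open>F\<close>, so it is still at most \<open>t\<close> just before that mark; the jump
  there carries it past \<open>t\<close>. Hence \<open>t\<close> lies in a sojourn interval and the process is not at \<open>\<infinity>\<close>
  (\<open>K_process_leaves_infinity\<close>).

  The probability of \<open>D\<close> is \<open>1 - exp (- s \<Lambda>)\<close>. On \<open>D\<close>, each of the other two events fails with
  probability at most one quarter of that of \<open>D\<close>. A first sojourn is short with probability at
  most \<open>t / \<gamma> x\<close>, independently of \<open>D\<close>, and the finite sum of these bounds vanishes with \<open>t\<close>. The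
  clock outside \<open>F\<close> is independent of \<open>D\<close> and has mean at most \<open>s m\<close>, so Markov's inequality bounds
  the probability that it is large (\<open>nn_integral_rest_clock_on_mark_event\<close>). Therefore
  the process is away from \<open>\<infinity>\<close> at time \<open>t\<close> with probability at least
  \<open>(1 - exp (- \<delta> t \<Lambda>)) / 2\<close> (\<open>trans_prob_infinity_le\<close>), and this number is at least
  \<open>\<delta> \<Lambda> t / 4\<close> for small \<open>t\<close>. Since \<open>\<delta>\<close> does not
  depend on \<open>F\<close>, the factor \<open>\<delta> \<Lambda> / 4\<close> can be made as large as desired.
\<close>

section \<open>Infinite sums in the extended nonnegative reals\<close>

text \<open>
  The clock is an unordered infinite sum, whereas monotone convergence, Fubini and measurability are
  at hand for integrals against a counting measure. An inequality is enough to pass from one to the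
  other; the terms on \<open>F\<close> are dropped at the same time because they are the ones that vanish before
  the first mark of \<open>F\<close>.
\<close>

lemma infsum_ennreal_le_nn_integral:
  fixes f :: "'a \<Rightarrow> ennreal"
  assumes "\<And>x. x \<in> F \<Longrightarrow> f x = 0"
  shows "(\<Sum>\<^sub>\<infinity>x\<in>UNIV. f x) \<le> (\<integral>\<^sup>+x. f x \<partial>count_space (- F))"
proof (rule infsum_le_finite_sums)
  fix A :: "'a set" assume "finite A"
  then have "sum f A = (\<integral>\<^sup>+x. f x \<partial>count_space A)"
    by (simp add: nn_integral_count_space_finite)
  also have "\<dots> \<le> (\<integral>\<^sup>+x. f x \<partial>count_space (- F))"
    using assms by (auto simp: nn_integral_count_space_indicator intro!: nn_integral_mono split: split_indicator)
  finally show "sum f A \<le> (\<integral>\<^sup>+x. f x \<partial>count_space (- F))" .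
qed (rule nonneg_summable_on_complete, simp)

lemma term_le_infsum_ennreal: "f x \<le> (\<Sum>\<^sub>\<infinity>z\<in>UNIV. f z)" for f :: "'a \<Rightarrow> ennreal"
  using infsum_mono_neutral[of f "{x}" f UNIV] by (auto simp: nonneg_summable_on_complete)

lemma nn_integral_finite_of_summable_on:
  fixes f :: "'a \<Rightarrow> real"
  assumes summable: "f summable_on UNIV" and nonneg: "\<And>x. 0 \<le> f x"
  obtains m where "0 \<le> m" "(\<integral>\<^sup>+x. ennreal (f x) \<partial>count_space UNIV) \<le> ennreal m"
proof
  have "(\<lambda>x. norm (f x)) summable_on UNIV"
    using summable nonneg by simp
  from abs_summable_equivalent[THEN iffD1, OF this]
  show "(\<integral>\<^sup>+x. ennreal (f x) \<partial>count_space UNIV) \<le> ennreal (infsetsum f UNIV)"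
    using nonneg by (simp add: nn_integral_conv_infsetsum)
  show "0 \<le> infsetsum f UNIV"
    using nonneg by (rule infsetsum_nonneg)
qed

text \<open>
  Writing a sum of random length as an infinite series lets integral and sum be exchanged.
\<close>

lemma sum_upto_eq_suminf:
  fixes f :: "nat \<Rightarrow> ennreal"
  shows "(\<Sum>i=1..n. f i) = (\<Sum>k. indicator {..<n} k * f (Suc k))"
proof -
  have "(\<Sum>k. indicator {..<n} k * f (Suc k)) = (\<Sum>k<n. indicator {..<n} k * f (Suc k))"
    by (intro suminf_finite) auto
  then show ?thesis
    by (simp add: sum.atLeast1_atMost_eq)
qed

section \<open>Independence and Poisson processes\<close>

lemma nn_integral_poisson_pmf:
  assumes "0 < r"
  shows "(\<integral>\<^sup>+n. of_nat n \<partial>measure_pmf (poisson_pmf r)) = ennreal r"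
proof -
  have exp_sums: "(\<lambda>n. r ^ n / fact n) sums exp r"
    using exp_converges[of r] by (simp add: divide_inverse mult.commute)
  have "(\<lambda>n. r * exp (- r) * (r ^ n / fact n)) sums (r * exp (- r) * exp r)"
    by (intro sums_mult exp_sums)
  then have "(\<lambda>n. pmf (poisson_pmf r) (Suc n) * real (Suc n)) sums r"
    using assms by (simp add: exp_minus field_simps del: of_nat_Suc)
  then have "(\<lambda>n. pmf (poisson_pmf r) n * real n) sums r"
    by (subst (asm) sums_Suc_iff) simp
  then have "(\<Sum>n. ennreal (pmf (poisson_pmf r) n * real n)) = ennreal r"
    by (intro suminf_ennreal_eq) auto
  then show ?thesis
    by (simp add: nn_integral_measure_pmf nn_integral_count_space_nat ennreal_mult ennreal_of_nat_eq_real_of_nat)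
qed

text \<open>
  The sigma-algebras that \<open>X\<close> and \<open>Y\<close> generate are contained in \<open>A\<close> and \<open>B\<close>, and independence is
  inherited by smaller families of events.
\<close>

lemma (in prob_space) indep_var_of_indep_set:
  assumes indep: "indep_set (sets A) (sets B)"
    and X: "X \<in> A \<rightarrow>\<^sub>M S" and Y: "Y \<in> B \<rightarrow>\<^sub>M N"
    and space: "space A = space M" "space B = space M"
  shows "indep_var S X N Y"
proof -
  have X': "sigma_sets (space A) {X -` C \<inter> space A |C. C \<in> sets S} \<subseteq> sets A"
    using measurable_sets[OF X] by (intro sets.sigma_sets_subset) auto
  have Y': "sigma_sets (space B) {Y -` C \<inter> space B |C. C \<in> sets N} \<subseteq> sets B"
    using measurable_sets[OF Y] by (intro sets.sigma_sets_subset) auto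
  have events: "sets A \<subseteq> events" "sets B \<subseteq> events"
    using indep by (auto simp: indep_sets2_eq)
  then have "random_variable S X" "random_variable N Y"
    using events space
    by (auto intro!: measurable_from_subalg[OF _ X] measurable_from_subalg[OF _ Y] simp only: subalgebra_def)
  moreover have "indep_set
     (sigma_sets (space M) {X -` C \<inter> space M |C. C \<in> sets S})
     (sigma_sets (space M) {Y -` C \<inter> space M |C. C \<in> sets N})"
    unfolding indep_set_def
  proof (rule indep_sets_mono_sets)
    show "indep_sets (case_bool (sets A) (sets B)) UNIV"
      using indep by (simp add: indep_set_def)
  qed (use X' Y' in \<open>simp add: space split: bool.split\<close>)
  ultimately show ?thesis
    unfolding indep_var_eq by (intro conjI)
qed

context
  fixes M :: "'w measure" and r :: real and \<sigma> :: "nat \<Rightarrow> 'w \<Rightarrow> real"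
  assumes pp: "poisson_process M r \<sigma>"
begin

lemma first_mark_pos: "\<omega> \<in> space M \<Longrightarrow> 0 < \<sigma> 1 \<omega>"
  using pp by (auto simp: poisson_process_def)

lemma finite_marks: "\<omega> \<in> space M \<Longrightarrow> finite {i. 1 \<le> i \<and> \<sigma> i \<omega> \<le> t}"
  using pp by (auto simp: poisson_process_def)

lemma first_mark_le:
  assumes "\<omega> \<in> space M" "1 \<le> i" shows "\<sigma> 1 \<omega> \<le> \<sigma> i \<omega>"
  using assms(2)
proof (induction i rule: dec_induct)
  case (step n)
  then have "\<sigma> n \<omega> < \<sigma> (Suc n) \<omega>"
    using pp assms(1) by (auto simp: poisson_process_def)
  with step show ?case by simp
qed simp

lemma counting_pos_iff: "\<omega> \<in> space M \<Longrightarrow> 0 < counting \<sigma> t \<omega> \<longleftrightarrow> \<sigma> 1 \<omega> \<le> t"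
  using finite_marks[of \<omega> t] first_mark_le[of \<omega>]
  by (force simp: counting_def card_gt_0_iff)

lemma counting_mono: "\<omega> \<in> space M \<Longrightarrow> s \<le> t \<Longrightarrow> counting \<sigma> s \<omega> \<le> counting \<sigma> t \<omega>"
  unfolding counting_def by (rule card_mono[OF finite_marks]) auto

lemma distr_counting:
  assumes "0 < t"
  shows "distr M (count_space UNIV) (counting \<sigma> t) = measure_pmf (poisson_pmf (r * t))"
proof -
  have "counting \<sigma> 0 \<omega> = 0" if "\<omega> \<in> space M" for \<omega>
    using counting_pos_iff[OF that, of 0] first_mark_pos[OF that] by simp
  then have "distr M (count_space UNIV) (counting \<sigma> t)
      = distr M (count_space UNIV) (\<lambda>\<omega>. counting \<sigma> t \<omega> - counting \<sigma> 0 \<omega>)"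
    by (intro distr_cong) auto
  also have "\<dots> = measure_pmf (poisson_pmf (r * (t - 0)))"
    using pp assms unfolding poisson_process_def by blast
  finally show ?thesis by simp
qed

end

section \<open>Leaving infinity along a path\<close>

lemma clock_infinity_before_marks:
  assumes "\<And>z. z \<in> F \<Longrightarrow> counting (\<sigma> z) s \<omega> = 0"
  shows "clock \<gamma> c \<sigma> T0 T None s \<omega>
    \<le> (\<integral>\<^sup>+z. (\<Sum>i=1..counting (\<sigma> z) s \<omega>. ennreal (\<gamma> z * T z i \<omega>)) \<partial>count_space (- F)) + ennreal (c * s)"
  unfolding clock_def ext_gamma_def
  using assms by (auto intro!: add_mono infsum_ennreal_le_nn_integral)

text \<open>
  The deterministic core. Among the states of \<open>F\<close>, let \<open>x\<close> be one whose first mark is earliest.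
  Before that mark no state of \<open>F\<close> has contributed to the clock, so the left limit there is at most
  the clock of the other states, with drift, at the later time \<open>s\<close>, hence at most \<open>t\<close>. At the mark the
  first sojourn at \<open>x\<close> is added, and this alone exceeds \<open>t\<close>.
\<close>

lemma K_process_leaves_infinity:
  fixes \<sigma> :: "'s::countable \<Rightarrow> nat \<Rightarrow> 'w \<Rightarrow> real"
  assumes pp: "\<And>x. poisson_process M (rate x) (\<sigma> x)"
    and \<omega>: "\<omega> \<in> space M" and c: "0 \<le> c" and t: "0 < t" and F: "finite F"
    and mark: "\<exists>x\<in>F. 0 < counting (\<sigma> x) s \<omega>"
    and long: "\<And>x. x \<in> F \<Longrightarrow> t < \<gamma> x * T x 1 \<omega>"
    and rest: "(\<integral>\<^sup>+z. (\<Sum>i=1..counting (\<sigma> z) s \<omega>. ennreal (\<gamma> z * T z i \<omega>)) \<partial>count_space (- F))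
        + ennreal (c * s) \<le> ennreal t"
  shows "K_process \<gamma> c \<sigma> T0 T None t \<omega> \<noteq> None"
proof -
  let ?\<Gamma> = "\<lambda>u. clock \<gamma> c \<sigma> T0 T None u \<omega>"
  obtain x where x: "x \<in> F" and first: "\<And>z. z \<in> F \<Longrightarrow> \<sigma> x 1 \<omega> \<le> \<sigma> z 1 \<omega>"
    using ex_is_arg_min_if_finite[OF F, of "\<lambda>z. \<sigma> z 1 \<omega>"] mark
    by (auto simp: is_arg_min_linorder)
  have xs: "\<sigma> x 1 \<omega> \<le> s"
    using mark first counting_pos_iff[OF pp \<omega>] by (meson order_trans)
  have mono: "?\<Gamma> u \<le> ?\<Gamma> v" if "u \<le> v" for u v
    unfolding clock_def using that c counting_mono[OF pp \<omega>]
    by (intro add_mono infsum_mono sum_mono2) (auto intro!: ennreal_leI mult_left_mono nonneg_summable_on_complete)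
  have bound: "?\<Gamma> u \<le> ennreal t" if "u < \<sigma> x 1 \<omega>" for u
  proof -
    have "?\<Gamma> u \<le> (\<integral>\<^sup>+z. (\<Sum>i=1..counting (\<sigma> z) u \<omega>. ennreal (\<gamma> z * T z i \<omega>)) \<partial>count_space (- F))
        + ennreal (c * u)"
      using counting_pos_iff[OF pp \<omega>] first that
      by (intro clock_infinity_before_marks) (metis gr0I leD order_trans)
    also have "\<dots> \<le> (\<integral>\<^sup>+z. (\<Sum>i=1..counting (\<sigma> z) s \<omega>. ennreal (\<gamma> z * T z i \<omega>)) \<partial>count_space (- F))
        + ennreal (c * s)"
      using that xs c counting_mono[OF pp \<omega>, of u s]
      by (intro add_mono nn_integral_mono sum_mono2) (auto intro!: ennreal_leI mult_left_mono)
    finally show ?thesis using rest by simp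
  qed
  \<comment> \<open>A monotone function has a left limit, its supremum to the left; this identifies \<open>Lim\<close>.\<close>
  have "(?\<Gamma> \<longlongrightarrow> Sup (?\<Gamma> ` ({..<\<sigma> x 1 \<omega>} \<inter> UNIV))) (at (\<sigma> x 1 \<omega>) within ({..<\<sigma> x 1 \<omega>} \<inter> UNIV))"
    by (rule Lim_left_bound[where K="ennreal t"]) (auto intro: mono bound)
  then have "Lim (at_left (\<sigma> x 1 \<omega>)) ?\<Gamma> = Sup (?\<Gamma> ` {..<\<sigma> x 1 \<omega>})"
    by (intro tendsto_Lim) (auto simp: trivial_limit_at_left_real)
  also have "\<dots> \<le> ennreal t"
    using bound by (auto intro: Sup_least)
  finally have lower: "Lim (at_left (\<sigma> x 1 \<omega>)) ?\<Gamma> \<le> ennreal t" .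
  have "ennreal t < ennreal (\<gamma> x * T x 1 \<omega>)"
    using long[OF x] t by (simp add: ennreal_less_iff)
  also have "\<dots> \<le> (\<Sum>i=1..counting (\<sigma> x) (\<sigma> x 1 \<omega>) \<omega>. ennreal (\<gamma> x * T x i \<omega>))"
    using counting_pos_iff[OF pp \<omega>, of x "\<sigma> x 1 \<omega>"]
    by (intro member_le_sum) auto
  also have "\<dots> \<le> ?\<Gamma> (\<sigma> x 1 \<omega>)"
    unfolding clock_def
    using term_le_infsum_ennreal[of "\<lambda>z. \<Sum>i=1..counting (\<sigma> z) (\<sigma> x 1 \<omega>) \<omega>. ennreal (\<gamma> z * T z i \<omega>)" x]
    by (simp add: add_increasing add_increasing2)
  finally have "in_sojourn \<gamma> c \<sigma> T0 T None t \<omega> x"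
    unfolding in_sojourn_def using lower by (intro UN_I[of 1]) auto
  then show ?thesis
    using t by (auto simp: K_process_def ext_gamma_def)
qed

section \<open>Independence of the marks and the sojourn lengths\<close>

locale K_process_inputs = prob_space M for M :: "'w measure" +
  fixes \<gamma> rate :: "'s::countable \<Rightarrow> real" and c :: real
    and \<sigma> :: "'s \<Rightarrow> nat \<Rightarrow> 'w \<Rightarrow> real" and T0 :: "'w \<Rightarrow> real"
    and T :: "'s \<Rightarrow> nat \<Rightarrow> 'w \<Rightarrow> real"
  assumes gamma_pos: "0 < \<gamma> x" and rate_pos: "0 < rate x" and c_nonneg: "0 \<le> c"
    and poisson: "poisson_process M (rate x) (\<sigma> x)"
    and exponential: "1 \<le> n \<Longrightarrow> distributed M lborel (T x n) (exponential_density 1)"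
    and independent: "independent_inputs M \<sigma> T0 T"
begin

text \<open>
  The sigma-algebras of the Poisson processes and of the exponential variables. They are kept as
  opaque constants: all that matters later is that \<open>counting\<close> and \<open>T\<close> are measurable with respect to
  them, and that they are independent.
\<close>

definition path_algebra :: "'w measure" where
  "path_algebra =
     vimage_algebra (space M) (\<lambda>\<omega> x. path (\<sigma> x) \<omega>) (PiM UNIV (\<lambda>_. path_space))"

definition exp_algebra :: "'w measure" where
  "exp_algebra = vimage_algebra (space M)
     (\<lambda>\<omega>. \<lambda>k\<in>exp_index. exp_family T0 T k \<omega>) (PiM exp_index (\<lambda>_. borel))"

lemma space_path_algebra [simp]: "space path_algebra = space M"
  by (simp add: path_algebra_def)

lemma space_exp_algebra [simp]: "space exp_algebra = space M"
  by (simp add: exp_algebra_def)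

lemma path_in_space: "path (\<sigma> x) \<omega> \<in> space path_space"
  by (auto simp: path_def space_PiM PiE_def)

lemma counting_path_algebra_measurable:
  assumes "0 \<le> s"
  shows "counting (\<sigma> x) s \<in> path_algebra \<rightarrow>\<^sub>M count_space UNIV"
proof -
  have "(\<lambda>\<omega> x. path (\<sigma> x) \<omega>) \<in> path_algebra \<rightarrow>\<^sub>M PiM UNIV (\<lambda>_. path_space)"
    unfolding path_algebra_def using path_in_space by (intro measurable_vimage_algebra1) (auto simp: space_PiM)
  from measurable_compose[OF this measurable_component_singleton[of x UNIV "\<lambda>_. path_space"]]
  have "path (\<sigma> x) \<in> path_algebra \<rightarrow>\<^sub>M path_space"
    by simp
  from measurable_compose[OF this measurable_component_singleton[of s "{0..}" "\<lambda>_. count_space UNIV"]]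
  show ?thesis
    using assms by (simp add: path_def)
qed

lemma T_exp_algebra_measurable:
  assumes "1 \<le> n"
  shows "T x n \<in> borel_measurable exp_algebra"
proof -
  have "(\<lambda>\<omega>. \<lambda>k\<in>exp_index. exp_family T0 T k \<omega>) \<in> exp_algebra \<rightarrow>\<^sub>M PiM exp_index (\<lambda>_. borel)"
    unfolding exp_algebra_def by (intro measurable_vimage_algebra1) (auto simp: space_PiM)
  from measurable_compose[OF this measurable_component_singleton[of "Some (x, n)"]] assms
  show ?thesis
    by (simp add: exp_family_def image_iff)
qed

lemma indep_path_exp: "indep_set (sets path_algebra) (sets exp_algebra)"
  using independent by (simp add: independent_inputs_def path_algebra_def exp_algebra_def)

lemma path_algebra_events: "A \<in> sets path_algebra \<Longrightarrow> A \<in> events"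
  by (rule subsetD[OF indep_path_exp[unfolded indep_sets2_eq, THEN conjunct1]])

lemma indep_var_path_exp:
  assumes "X \<in> path_algebra \<rightarrow>\<^sub>M S" and "Y \<in> exp_algebra \<rightarrow>\<^sub>M N"
  shows "indep_var S X N Y"
  using indep_path_exp assms
  by (rule indep_var_of_indep_set) simp_all

lemma measurable_counting [measurable]: "0 \<le> s \<Longrightarrow> counting (\<sigma> x) s \<in> M \<rightarrow>\<^sub>M count_space UNIV"
  by (rule measurable_from_subalg[OF _ counting_path_algebra_measurable])
    (auto simp: subalgebra_def path_algebra_events)

lemma measurable_T: "1 \<le> n \<Longrightarrow> T x n \<in> borel_measurable M"
  using exponential[of n x] by (auto simp: distributed_def)

lemma measurable_T_Suc [measurable]: "T x (Suc n) \<in> borel_measurable M"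
  by (simp add: measurable_T)

lemma prob_counting_eq_0:
  assumes "0 < s"
  shows "prob {\<omega> \<in> space M. counting (\<sigma> x) s \<omega> = 0} = exp (- (rate x * s))"
proof -
  have "{\<omega> \<in> space M. counting (\<sigma> x) s \<omega> = 0} = counting (\<sigma> x) s -` {0} \<inter> space M"
    by auto
  then have "prob {\<omega> \<in> space M. counting (\<sigma> x) s \<omega> = 0}
      = measure (distr M (count_space UNIV) (counting (\<sigma> x) s)) {0}"
    using assms by (simp add: measure_distr)
  also have "\<dots> = exp (- (rate x * s))"
    using assms rate_pos[of x] by (simp add: distr_counting[OF poisson] measure_pmf_single)
  finally show ?thesis .
qed

lemma nn_integral_counting:
  assumes "0 < s"
  shows "(\<integral>\<^sup>+\<omega>. of_nat (counting (\<sigma> x) s \<omega>) \<partial>M) = ennreal (rate x * s)"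
proof -
  have "(\<integral>\<^sup>+\<omega>. of_nat (counting (\<sigma> x) s \<omega>) \<partial>M)
      = (\<integral>\<^sup>+n. of_nat n \<partial>distr M (count_space UNIV) (counting (\<sigma> x) s))"
    using assms by (intro nn_integral_distr[where f = of_nat, symmetric]) simp_all
  then show ?thesis
    using assms rate_pos[of x] by (simp add: distr_counting[OF poisson] nn_integral_poisson_pmf)
qed

text \<open>
  The integrand may be negative on a null set, where \<open>ennreal\<close> cuts it off at \<open>0\<close>; the density
  vanishes there.
\<close>

lemma nn_integral_exponential:
  assumes "1 \<le> n" "0 \<le> a"
  shows "(\<integral>\<^sup>+\<omega>. ennreal (a * T x n \<omega>) \<partial>M) = ennreal a"
proof -
  have density_nonneg: "0 \<le> exponential_density 1 y" for y
    by (simp add: erlang_density_nonneg)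
  have "(\<integral>\<^sup>+\<omega>. ennreal (a * T x n \<omega>) \<partial>M)
      = (\<integral>\<^sup>+y. ennreal (exponential_density 1 y) * ennreal (a * y) \<partial>lborel)"
    by (rule distributed_nn_integral[OF exponential[OF assms(1)], symmetric,
          where g = "\<lambda>y. ennreal (a * y)"]) simp
  also have "\<dots> = (\<integral>\<^sup>+y. ennreal a * ennreal (erlang_density 0 1 y * y ^ 1) \<partial>lborel)"
    using assms(2)
    by (intro nn_integral_cong)
      (unfold ennreal_mult'[OF density_nonneg, symmetric] ennreal_mult'[OF assms(2), symmetric],
        simp add: ac_simps)
  also have "\<dots> = ennreal a"
    using nn_integral_erlang_ith_moment[of 1 0 1] by (simp add: nn_integral_cmult)
  finally show ?thesis .
qed

lemma nn_integral_exponential_on_path_event: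
  assumes A: "A \<in> sets path_algebra" and n: "1 \<le> n" and a: "0 \<le> a"
  shows "(\<integral>\<^sup>+\<omega>. indicator A \<omega> * ennreal (a * T x n \<omega>) \<partial>M) = emeasure M A * ennreal a"
proof -
  have [measurable]: "A \<in> events" using path_algebra_events[OF A] .
  have [measurable]: "T x n \<in> borel_measurable M" using measurable_T[OF n] .
  have indicator: "(indicator A :: _ \<Rightarrow> ennreal) \<in> borel_measurable path_algebra"
    using A by (rule borel_measurable_indicator)
  have "(\<lambda>\<omega>. ennreal (a * T x n \<omega>)) \<in> borel_measurable exp_algebra"
    by (rule measurable_compose[OF T_exp_algebra_measurable[OF n, of x]]) measurable
  with indicator have "indep_var borel (indicator A :: _ \<Rightarrow> ennreal) borel (\<lambda>\<omega>. ennreal (a * T x n \<omega>))"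
    by (rule indep_var_path_exp)
  then have "indep_vars (\<lambda>_. borel)
      (case_bool (indicator A :: _ \<Rightarrow> ennreal) (\<lambda>\<omega>. ennreal (a * T x n \<omega>))) UNIV"
    unfolding indep_var_def by (rule indep_vars_cong[THEN iffD1, rotated -1]) (auto split: bool.split)
  then have "(\<integral>\<^sup>+\<omega>. (\<Prod>b\<in>UNIV. case_bool (indicator A :: _ \<Rightarrow> ennreal) (\<lambda>\<omega>. ennreal (a * T x n \<omega>)) b \<omega>) \<partial>M)
    = (\<Prod>b\<in>UNIV. \<integral>\<^sup>+\<omega>. case_bool (indicator A :: _ \<Rightarrow> ennreal) (\<lambda>\<omega>. ennreal (a * T x n \<omega>)) b \<omega> \<partial>M)"
    by (intro indep_vars_nn_integral) auto
  then show ?thesis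
    using nn_integral_exponential[OF n a, of x] by (simp add: UNIV_bool mult.commute)
qed

section \<open>Marks in a finite set of states\<close>

definition mark_event :: "'s set \<Rightarrow> real \<Rightarrow> 'w set" where
  "mark_event F s = {\<omega> \<in> space M. \<exists>x\<in>F. 0 < counting (\<sigma> x) s \<omega>}"

text \<open>
  The clock without the states of \<open>F\<close>, the drift and the initial sojourn; the sum over states is
  an integral against the counting measure.
\<close>

definition rest_clock :: "'s set \<Rightarrow> real \<Rightarrow> 'w \<Rightarrow> ennreal" where
  "rest_clock F s \<omega> =
     (\<integral>\<^sup>+z. (\<Sum>i=1..counting (\<sigma> z) s \<omega>. ennreal (\<gamma> z * T z i \<omega>)) \<partial>count_space (- F))"

lemma counting_event_path_algebra:
  "0 \<le> s \<Longrightarrow> {\<omega> \<in> space M. n < counting (\<sigma> x) s \<omega>} \<in> sets path_algebra"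
  using measurable_sets[OF counting_path_algebra_measurable, of s "{n<..}" x]
  by (simp add: vimage_def Int_def conj_commute)

lemma mark_event_path_algebra:
  assumes "finite F" "0 \<le> s"
  shows "mark_event F s \<in> sets path_algebra"
proof -
  have "mark_event F s = (\<Union>x\<in>F. {\<omega> \<in> space M. 0 < counting (\<sigma> x) s \<omega>})"
    by (auto simp: mark_event_def)
  with assms show ?thesis
    by (auto intro!: sets.finite_UN counting_event_path_algebra)
qed

text \<open>
  Independence of the paths, evaluated at the single time \<open>s\<close>. The sets \<open>C x\<close> may vary with the
  state, so that the lemma covers both the absence of marks on \<open>F\<close> and its combination with a
  condition on one further state.
\<close>

lemma prob_all_counting:
  assumes "finite F" "0 \<le> s"
  shows "prob {\<omega> \<in> space M. \<forall>x\<in>F. counting (\<sigma> x) s \<omega> \<in> C x}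
    = (\<Prod>x\<in>F. prob {\<omega> \<in> space M. counting (\<sigma> x) s \<omega> \<in> C x})"
proof (cases "F = {}")
  case False
  have paths: "path (\<sigma> x) -` {p \<in> space path_space. p s \<in> C x} \<inter> space M
      = {\<omega> \<in> space M. counting (\<sigma> x) s \<omega> \<in> C x}" for x
    using assms path_in_space[of x] by (auto simp: path_def)
  have "prob (\<Inter>x\<in>F. path (\<sigma> x) -` {p \<in> space path_space. p s \<in> C x} \<inter> space M)
      = (\<Prod>x\<in>F. prob (path (\<sigma> x) -` {p \<in> space path_space. p s \<in> C x} \<inter> space M))"
  proof (rule indep_varsD)
    show "indep_vars (\<lambda>_. path_space) (\<lambda>x. path (\<sigma> x)) UNIV"
      using independent by (simp add: independent_inputs_def)
    have "(\<lambda>p. p s) \<in> path_space \<rightarrow>\<^sub>M count_space UNIV"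
      using assms by (intro measurable_component_singleton) simp
    from measurable_sets[OF this]
    show "{p \<in> space path_space. p s \<in> C x} \<in> sets path_space" for x
      by (simp add: vimage_def Int_def conj_commute)
  qed (use assms False in auto)
  moreover have "(\<Inter>x\<in>F. {\<omega> \<in> space M. counting (\<sigma> x) s \<omega> \<in> C x})
      = {\<omega> \<in> space M. \<forall>x\<in>F. counting (\<sigma> x) s \<omega> \<in> C x}"
    using False by auto
  ultimately show ?thesis
    by (simp only: paths)
qed (simp add: prob_space)

lemma prob_mark_event:
  assumes "finite F" "0 < s"
  shows "prob (mark_event F s) = 1 - exp (- (s * sum rate F))"
proof -
  have "mark_event F s = space M - {\<omega> \<in> space M. \<forall>x\<in>F. counting (\<sigma> x) s \<omega> \<in> {0}}"
    by (auto simp: mark_event_def)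
  moreover have "prob {\<omega> \<in> space M. \<forall>x\<in>F. counting (\<sigma> x) s \<omega> \<in> {0}} = exp (- (s * sum rate F))"
    using assms prob_all_counting[of F s "\<lambda>_. {0}"]
    by (simp add: prob_counting_eq_0 exp_sum[symmetric] sum_negf sum_distrib_left mult.commute)
  moreover have "{\<omega> \<in> space M. \<forall>x\<in>F. counting (\<sigma> x) s \<omega> \<in> {0}} \<in> events"
  proof -
    have "{\<omega> \<in> space M. \<forall>x\<in>F. counting (\<sigma> x) s \<omega> \<in> {0}} = space M - mark_event F s"
      by (auto simp: mark_event_def)
    then show ?thesis
      using path_algebra_events[OF mark_event_path_algebra] assms by auto
  qed
  ultimately show ?thesis
    by (simp add: prob_compl)
qed

text \<open>
  The complement of \<open>mark_event F s\<close> is an intersection of events about the single states of \<open>F\<close>, and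
  it is for such intersections that independence gives a product.
\<close>

lemma prob_mark_event_Int:
  assumes F: "finite F" and s: "0 \<le> s" and z: "z \<notin> F"
  shows "prob (mark_event F s \<inter> {\<omega> \<in> space M. n < counting (\<sigma> z) s \<omega>})
    = prob (mark_event F s) * prob {\<omega> \<in> space M. n < counting (\<sigma> z) s \<omega>}"
proof -
  let ?D = "mark_event F s" and ?B = "{\<omega> \<in> space M. n < counting (\<sigma> z) s \<omega>}"
  have D: "?D \<in> events" and B: "?B \<in> events"
    by (rule path_algebra_events[OF mark_event_path_algebra[OF F s]],
        rule path_algebra_events[OF counting_event_path_algebra[OF s]])
  define C where "C x = (if x = z then {n<..} else {0::nat})" for x
  have "prob ((space M - ?D) \<inter> ?B) = prob {\<omega> \<in> space M. \<forall>x\<in>insert z F. counting (\<sigma> x) s \<omega> \<in> C x}"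
    using z by (intro arg_cong[where f=prob]) (auto simp: mark_event_def C_def)
  also have "\<dots> = prob ?B * prob {\<omega> \<in> space M. \<forall>x\<in>F. counting (\<sigma> x) s \<omega> \<in> C x}"
  proof -
    have "{\<omega> \<in> space M. counting (\<sigma> z) s \<omega> \<in> C z} = ?B"
      by (simp add: C_def)
    moreover have "finite (insert z F)"
      using F by simp
    ultimately show ?thesis
      by (simp only: prob_all_counting[OF _ s] F prod.insert[OF F z])
  qed
  also have "{\<omega> \<in> space M. \<forall>x\<in>F. counting (\<sigma> x) s \<omega> \<in> C x} = space M - ?D"
    using z by (auto simp: mark_event_def C_def)
  finally have "prob ((space M - ?D) \<inter> ?B) = prob ?B * (1 - prob ?D)"
    using D by (simp add: prob_compl)
  moreover have "prob ?B = prob (?D \<inter> ?B) + prob ((space M - ?D) \<inter> ?B)"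
    using D B by (subst finite_measure_Union[symmetric]) (auto intro!: arg_cong[where f=prob])
  ultimately show ?thesis
    by (simp add: algebra_simps)
qed

section \<open>The clock of the remaining states\<close>

lemma measurable_mark_sum:
  assumes "0 \<le> s"
  shows "(\<lambda>\<omega>. \<Sum>i=1..counting (\<sigma> z) s \<omega>. ennreal (\<gamma> z * T z i \<omega>)) \<in> borel_measurable M"
  using assms unfolding sum_upto_eq_suminf by measurable

lemma measurable_rest_clock:
  assumes "0 \<le> s"
  shows "rest_clock F s \<in> borel_measurable M"
proof -
  interpret C: sigma_finite_measure "count_space (- F)"
    by (rule sigma_finite_measure_count_space_countable) auto
  have "(\<lambda>(z, \<omega>). \<Sum>i=1..counting (\<sigma> z) s \<omega>. ennreal (\<gamma> z * T z i \<omega>))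
      \<in> borel_measurable (count_space (- F) \<Otimes>\<^sub>M M)"
    using measurable_mark_sum[OF assms] by (intro measurable_pair_measure_countable1) auto
  then have "(\<lambda>(\<omega>, z). \<Sum>i=1..counting (\<sigma> z) s \<omega>. ennreal (\<gamma> z * T z i \<omega>))
      \<in> borel_measurable (M \<Otimes>\<^sub>M count_space (- F))"
    by (subst measurable_pair_swap_iff) (simp add: case_prod_beta')
  from C.borel_measurable_nn_integral[OF this] show ?thesis
    by (simp add: rest_clock_def[abs_def])
qed

text \<open>
  Given a mark in \<open>F\<close>, the mean of the remaining clock is the unconditional one, \<open>s\<close> times the sum
  of \<open>rate z * \<gamma> z\<close>. The contribution of the \<open>k\<close>-th mark of \<open>z\<close> carries the indicator that this
  mark occurs by time \<open>s\<close>. Together with the mark in \<open>F\<close> this is an event of the Poisson processes,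
  hence independent of the sojourn length \<open>T z k\<close>; and it factors because \<open>z\<close> is not in \<open>F\<close>. Summing
  the tail probabilities over \<open>k\<close> gives the Poisson mean \<open>rate z * s\<close>.
\<close>

lemma nn_integral_rest_clock_on_mark_event:
  assumes F: "finite F" and s: "0 < s"
  shows "(\<integral>\<^sup>+\<omega>. rest_clock F s \<omega> * indicator (mark_event F s) \<omega> \<partial>M)
    = emeasure M (mark_event F s) * (\<integral>\<^sup>+z. ennreal (s * (rate z * \<gamma> z)) \<partial>count_space (- F))"
proof -
  let ?D = "mark_event F s" and ?B = "\<lambda>z k. {\<omega> \<in> space M. k < counting (\<sigma> z) s \<omega>}"
  have s0: "0 \<le> s" using s by simp
  have D: "?D \<in> events"
    using path_algebra_events[OF mark_event_path_algebra[OF F s0]] .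
  have DB: "?D \<inter> ?B z k \<in> sets path_algebra" for z k
    by (intro sets.Int mark_event_path_algebra counting_event_path_algebra F s0)
  have per_state: "(\<integral>\<^sup>+\<omega>. (\<Sum>i=1..counting (\<sigma> z) s \<omega>. ennreal (\<gamma> z * T z i \<omega>)) * indicator ?D \<omega> \<partial>M)
      = emeasure M ?D * ennreal (s * (rate z * \<gamma> z))" if z: "z \<in> - F" for z
  proof -
    have "(\<integral>\<^sup>+\<omega>. (\<Sum>i=1..counting (\<sigma> z) s \<omega>. ennreal (\<gamma> z * T z i \<omega>)) * indicator ?D \<omega> \<partial>M)
        = (\<integral>\<^sup>+\<omega>. (\<Sum>k. indicator (?D \<inter> ?B z k) \<omega> * ennreal (\<gamma> z * T z (Suc k) \<omega>)) \<partial>M)"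
      unfolding sum_upto_eq_suminf ennreal_suminf_multc[symmetric]
      by (intro nn_integral_cong suminf_cong) (auto split: split_indicator)
    also have "\<dots> = (\<Sum>k. \<integral>\<^sup>+\<omega>. indicator (?D \<inter> ?B z k) \<omega> * ennreal (\<gamma> z * T z (Suc k) \<omega>) \<partial>M)"
      by (intro nn_integral_suminf borel_measurable_times_ennreal borel_measurable_indicator
          path_algebra_events[OF DB]) measurable
    also have "\<dots> = (\<Sum>k. emeasure M (?D \<inter> ?B z k) * ennreal (\<gamma> z))"
      using gamma_pos[of z] by (intro suminf_cong nn_integral_exponential_on_path_event DB) auto
    also have "\<dots> = (\<Sum>k. emeasure M ?D * (emeasure M (?B z k) * ennreal (\<gamma> z)))"
      using z prob_mark_event_Int[OF F s0, of z]
      by (intro suminf_cong) (simp add: emeasure_eq_measure ennreal_mult mult.assoc)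
    also have "\<dots> = emeasure M ?D * ((\<Sum>k. emeasure M (?B z k)) * ennreal (\<gamma> z))"
      by simp
    also have "(\<Sum>k. emeasure M (?B z k)) = ennreal (rate z * s)"
      using nn_integral_counting[OF s, of z] measurable_counting[OF s0, of z]
      by (simp add: nn_integral_nat_function)
    also have "ennreal (rate z * s) * ennreal (\<gamma> z) = ennreal (s * (rate z * \<gamma> z))"
      using gamma_pos[of z] rate_pos[of z] s by (simp add: ennreal_mult[symmetric] ac_simps)
    finally show ?thesis .
  qed
  have "(\<integral>\<^sup>+\<omega>. rest_clock F s \<omega> * indicator ?D \<omega> \<partial>M)
      = (\<integral>\<^sup>+\<omega>. \<integral>\<^sup>+z. (\<Sum>i=1..counting (\<sigma> z) s \<omega>. ennreal (\<gamma> z * T z i \<omega>)) * indicator ?D \<omega>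
          \<partial>count_space (- F) \<partial>M)"
    by (simp add: rest_clock_def nn_integral_multc)
  also have "\<dots> = (\<integral>\<^sup>+z. \<integral>\<^sup>+\<omega>. (\<Sum>i=1..counting (\<sigma> z) s \<omega>. ennreal (\<gamma> z * T z i \<omega>)) * indicator ?D \<omega>
          \<partial>M \<partial>count_space (- F))"
    using measurable_mark_sum[OF s0] D by (intro nn_integral_count_space_nn_integral) auto
  also have "\<dots> = (\<integral>\<^sup>+z. emeasure M ?D * ennreal (s * (rate z * \<gamma> z)) \<partial>count_space (- F))"
    by (intro nn_integral_cong per_state) simp
  finally show ?thesis
    by (simp add: nn_integral_cmult)
qed

lemma prob_short_sojourn_on_mark_event:
  assumes F: "finite F" and s: "0 \<le> s" and a: "0 \<le> a"
  shows "prob (mark_event F s \<inter> {\<omega> \<in> space M. T x 1 \<omega> \<le> a}) \<le> prob (mark_event F s) * a"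
proof -
  have "{\<omega> \<in> space M. T x 1 \<omega> \<le> a} \<in> sets exp_algebra"
    using measurable_sets[OF T_exp_algebra_measurable, of 1 "{..a}" x]
    by (simp add: vimage_def Int_def conj_commute)
  then have "prob (mark_event F s \<inter> {\<omega> \<in> space M. T x 1 \<omega> \<le> a})
      = prob (mark_event F s) * prob {\<omega> \<in> space M. T x 1 \<omega> \<le> a}"
    using indep_setD[OF indep_path_exp mark_event_path_algebra[OF F s]] by simp
  also have "prob {\<omega> \<in> space M. T x 1 \<omega> \<le> a} = 1 - exp (- a)"
    using exponential_distributedD_le[OF exponential, of 1 a x] a by simp
  also have "\<dots> \<le> a"
    using exp_ge_add_one_self[of "- a"] by simp
  finally show ?thesis
    by (simp add: mult_left_mono)
qed

section \<open>The rate of leaving infinity\<close>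

text \<open>
  The two exceptional events, \<open>S\<close> (some first sojourn in \<open>F\<close> is short) and \<open>R\<close> (the remaining clock
  is large), each take away at most a quarter of the probability of a mark in \<open>F\<close>. The upper bound is
  obtained by covering the event of being at \<open>\<infinity>\<close> by a measurable set.
\<close>

lemma trans_prob_infinity_le:
  assumes F: "finite F" and t: "0 < t" and s: "0 < s" and drift: "c * s \<le> t / 2"
    and m: "(\<integral>\<^sup>+z. ennreal (rate z * \<gamma> z) \<partial>count_space UNIV) \<le> ennreal m" "0 \<le> m" "s * m \<le> t / 8"
    and sojourns: "(\<Sum>x\<in>F. t / \<gamma> x) \<le> 1 / 4"
  shows "trans_prob M \<gamma> c \<sigma> T0 T None None t \<le> 1 - (1 - exp (- (s * sum rate F))) / 2"
proof -
  let ?D = "mark_event F s"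
  define S where "S = (\<Union>x\<in>F. ?D \<inter> {\<omega> \<in> space M. T x 1 \<omega> \<le> t / \<gamma> x})"
  define R where "R = {\<omega> \<in> ?D. 1 \<le> ennreal (2 / t) * rest_clock F s \<omega>}"
  have D: "?D \<in> events"
    using path_algebra_events[OF mark_event_path_algebra[OF F]] s by simp
  have T_event: "{\<omega> \<in> space M. T x 1 \<omega> \<le> a} \<in> events" for x a
    using measurable_T[of 1 x] by simp
  have S: "S \<in> events"
    unfolding S_def by (rule sets.finite_UN[OF F sets.Int[OF D T_event]])
  have rest_measurable: "rest_clock F s \<in> borel_measurable M"
    using measurable_rest_clock s by simp
  have "{\<omega> \<in> space M. 1 \<le> ennreal (2 / t) * rest_clock F s \<omega>} \<in> events"
    using rest_measurable by measurable
  moreover have "R = ?D \<inter> {\<omega> \<in> space M. 1 \<le> ennreal (2 / t) * rest_clock F s \<omega>}"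
    by (auto simp: R_def mark_event_def)
  ultimately have R: "R \<in> events"
    using D by simp
  have "prob S \<le> (\<Sum>x\<in>F. prob (?D \<inter> {\<omega> \<in> space M. T x 1 \<omega> \<le> t / \<gamma> x}))"
    unfolding S_def using D T_event F by (intro finite_measure_subadditive_finite) auto
  also have "\<dots> \<le> (\<Sum>x\<in>F. prob ?D * (t / \<gamma> x))"
    using gamma_pos t s F
    by (intro sum_mono prob_short_sojourn_on_mark_event) (auto intro: less_imp_le)
  also have "\<dots> \<le> prob ?D * (1 / 4)"
    unfolding sum_distrib_left[symmetric] by (intro mult_left_mono sojourns) simp
  finally have prob_S: "prob S \<le> prob ?D / 4" by simp
  have "(\<integral>\<^sup>+z. ennreal (s * (rate z * \<gamma> z)) \<partial>count_space (- F))
      \<le> (\<integral>\<^sup>+z. ennreal s * ennreal (rate z * \<gamma> z) \<partial>count_space UNIV)"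
    using s by (auto simp: nn_integral_count_space_indicator ennreal_mult' intro!: nn_integral_mono
        split: split_indicator)
  also have "\<dots> \<le> ennreal s * ennreal m"
    using m by (simp add: nn_integral_cmult mult_left_mono)
  also have "\<dots> \<le> ennreal (t / 8)"
    using m s by (simp add: ennreal_mult[symmetric] ennreal_leI)
  finally have rest: "(\<integral>\<^sup>+z. ennreal (s * (rate z * \<gamma> z)) \<partial>count_space (- F)) \<le> ennreal (t / 8)" .
  \<comment> \<open>Half of \<open>t\<close> is reserved for the drift, so the remaining clock is compared with \<open>t / 2\<close>.\<close>
  have "emeasure M R \<le> ennreal (2 / t) * (\<integral>\<^sup>+\<omega>. rest_clock F s \<omega> * indicator ?D \<omega> \<partial>M)"
    unfolding R_def using measurable_rest_clock[of s F] s D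
    by (intro nn_integral_Markov_inequality) auto
  also have "\<dots> \<le> ennreal (2 / t) * (emeasure M ?D * ennreal (t / 8))"
    unfolding nn_integral_rest_clock_on_mark_event[OF F s] using rest by (intro mult_left_mono) auto
  also have "\<dots> = ennreal (prob ?D / 4)"
    using t by (simp add: emeasure_eq_measure ennreal_mult[symmetric])
  finally have prob_R: "prob R \<le> prob ?D / 4"
    by (simp add: emeasure_eq_measure)
  have leaves: "K_process \<gamma> c \<sigma> T0 T None t \<omega> \<noteq> None" if \<omega>: "\<omega> \<in> ?D - (S \<union> R)" for \<omega>
  proof (rule K_process_leaves_infinity[OF poisson _ c_nonneg t F, where s=s])
    show "\<omega> \<in> space M" "\<exists>x\<in>F. 0 < counting (\<sigma> x) s \<omega>"
      using \<omega> by (auto simp: mark_event_def)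
    show "t < \<gamma> x * T x 1 \<omega>" if "x \<in> F" for x
      using \<omega> that gamma_pos[of x] by (auto simp: S_def mark_event_def not_le field_simps)
    have "rest_clock F s \<omega> \<le> ennreal (t / 2)"
    proof (rule ccontr)
      assume "\<not> rest_clock F s \<omega> \<le> ennreal (t / 2)"
      then have "ennreal (2 / t) * ennreal (t / 2) \<le> ennreal (2 / t) * rest_clock F s \<omega>"
        by (intro mult_left_mono) auto
      then have "\<omega> \<in> R"
        using t \<omega> by (simp add: R_def ennreal_mult[symmetric])
      with \<omega> show False by simp
    qed
    then have "rest_clock F s \<omega> + ennreal (c * s) \<le> ennreal (t / 2) + ennreal (t / 2)"
      using drift by (intro add_mono ennreal_leI)
    also have "\<dots> = ennreal t"
      using t by (simp flip: ennreal_plus)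
    finally show "(\<integral>\<^sup>+z. (\<Sum>i=1..counting (\<sigma> z) s \<omega>. ennreal (\<gamma> z * T z i \<omega>)) \<partial>count_space (- F))
        + ennreal (c * s) \<le> ennreal t"
      by (simp add: rest_clock_def)
  qed
  have "{\<omega> \<in> space M. K_process \<gamma> c \<sigma> T0 T None t \<omega> = None} \<subseteq> space M - (?D - (S \<union> R))"
  proof
    fix \<omega>
    assume "\<omega> \<in> {\<omega> \<in> space M. K_process \<gamma> c \<sigma> T0 T None t \<omega> = None}"
    then show "\<omega> \<in> space M - (?D - (S \<union> R))"
      using leaves[of \<omega>] by auto
  qed
  then have "trans_prob M \<gamma> c \<sigma> T0 T None None t \<le> prob (space M - (?D - (S \<union> R)))"
    unfolding trans_prob_def using D S R by (intro finite_measure_mono) auto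
  also have "\<dots> = 1 - prob (?D - (S \<union> R))"
    using D S R by (intro prob_compl) auto
  also have "prob (?D - (S \<union> R)) = prob ?D - prob (S \<union> R)"
    using D S R by (intro finite_measure_Diff) (auto simp: S_def R_def)
  also have "1 - (prob ?D - prob (S \<union> R)) \<le> 1 - prob ?D / 2"
    using measure_Un_le[OF S R] prob_S prob_R by simp
  finally show ?thesis
    using prob_mark_event[OF F s] by simp
qed

end

lemma half_one_minus_exp_ge:
  fixes u :: real
  assumes "0 \<le> u" "u \<le> 1"
  shows "u / 4 \<le> (1 - exp (- u)) / 2"
proof -
  have "exp (- u) \<le> 1 / (1 + u)"
    using exp_ge_add_one_self[of u] assms by (simp add: exp_minus field_simps)
  also have "\<dots> \<le> 1 - u / 2"
    using mult_left_mono[of u 1 u] assms by (simp add: field_simps)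
  finally show ?thesis by simp
qed

text \<open>
  The order of the choices is what makes the rate infinite: \<open>\<delta>\<close> is fixed first, from \<open>c\<close> and \<open>m\<close>
  alone, then \<open>F\<close> from the required bound \<open>Z\<close>, and only then the range of \<open>t\<close>.
\<close>

lemma (in K_process_inputs) filterlim_trans_prob_infinity:
  assumes not_summable: "\<not> rate summable_on UNIV"
    and summable: "(\<lambda>x. rate x * \<gamma> x) summable_on UNIV"
  shows "filterlim (\<lambda>t. (trans_prob M \<gamma> c \<sigma> T0 T None None t - 1) / t) at_bot (at_right 0)"
proof -
  obtain m where m: "0 \<le> m" "(\<integral>\<^sup>+z. ennreal (rate z * \<gamma> z) \<partial>count_space UNIV) \<le> ennreal m"
    by (rule nn_integral_finite_of_summable_on[OF summable less_imp_le[OF mult_pos_pos[OF rate_pos gamma_pos]]])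
  \<comment> \<open>Small enough that by time \<open>\<delta> t\<close> the drift is at most \<open>t / 2\<close> and the mean of the jumps at most \<open>t / 8\<close>.\<close>
  define \<delta> where "\<delta> = 1 / (8 * (c + m + 1))"
  have \<delta>: "0 < \<delta>" "c * \<delta> \<le> 1 / 2" "\<delta> * m \<le> 1 / 8"
    using c_nonneg m by (auto simp: \<delta>_def field_simps)
  show ?thesis
    unfolding filterlim_at_bot
  proof
    fix Z :: real
    have "\<not> bdd_above (sum rate ` {F. F \<subseteq> UNIV \<and> finite F})"
      using not_summable nonneg_bdd_above_summable_on[of UNIV rate] rate_pos by (auto intro: less_imp_le)
    then have "\<exists>F. finite F \<and> 4 * \<bar>Z\<bar> / \<delta> + 1 < sum rate F"
      by (auto simp: bdd_above_def not_le)
    then obtain F where F: "finite F" and large: "4 * \<bar>Z\<bar> / \<delta> + 1 < sum rate F"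
      by blast
    define \<Lambda> where "\<Lambda> = sum rate F"
    have "0 \<le> 4 * \<bar>Z\<bar> / \<delta>"
      using \<delta> by simp
    with large have \<Lambda>: "0 < \<Lambda>" "4 * \<bar>Z\<bar> / \<delta> \<le> \<Lambda>"
      by (simp_all add: \<Lambda>_def)
    define G where "G = (\<Sum>x\<in>F. 1 / \<gamma> x)"
    have G: "0 \<le> G"
      unfolding G_def using gamma_pos by (intro sum_nonneg) (simp add: less_imp_le)
    \<comment> \<open>The first bound makes all first sojourns in \<open>F\<close> likely to exceed \<open>t\<close>; the second keeps the
          exponent \<open>\<delta> t \<Lambda>\<close> below \<open>1\<close>, where \<open>1 - exp (- u) \<ge> u / 2\<close>.\<close>
    define b where "b = min (1 / (4 * (G + 1))) (1 / (\<delta> * \<Lambda>))"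
    have b: "0 < b"
      using G \<delta> \<Lambda> by (simp add: b_def)
    have "(trans_prob M \<gamma> c \<sigma> T0 T None None t - 1) / t \<le> Z" if t: "0 < t" "t < b" for t
    proof -
      have small: "t * (4 * (G + 1)) < 1" "t * (\<delta> * \<Lambda>) < 1"
        using t(2) G \<delta> \<Lambda> by (simp_all add: b_def pos_less_divide_eq)
      have "(\<Sum>x\<in>F. t / \<gamma> x) = t * G"
        by (simp add: G_def sum_distrib_left)
      also have "\<dots> \<le> 1 / 4"
        using small(1) t(1) by (simp add: distrib_left)
      finally have tG: "(\<Sum>x\<in>F. t / \<gamma> x) \<le> 1 / 4" .
      have u: "\<delta> * t * \<Lambda> \<le> 1"
        using small(2) by (simp add: mult.assoc mult.left_commute)
      have u0: "0 \<le> \<delta> * t * \<Lambda>"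
        using \<delta> t \<Lambda> by simp
      have "trans_prob M \<gamma> c \<sigma> T0 T None None t \<le> 1 - (1 - exp (- (\<delta> * t * \<Lambda>))) / 2"
        unfolding \<Lambda>_def
      proof (rule trans_prob_infinity_le[OF F t(1) _ _ m(2,1) _ tG])
        show "c * (\<delta> * t) \<le> t / 2" "\<delta> * t * m \<le> t / 8"
          using mult_right_mono[OF \<delta>(2), of t] mult_right_mono[OF \<delta>(3), of t] t
          by (simp_all add: ac_simps)
      qed (use \<delta> t in simp)
      also have "\<dots> \<le> 1 - \<delta> * t * \<Lambda> / 4"
        using half_one_minus_exp_ge[OF u0 u] by (rule diff_left_mono)
      finally have "(trans_prob M \<gamma> c \<sigma> T0 T None None t - 1) / t \<le> - (\<delta> * \<Lambda> / 4)"
        using t by (simp add: field_simps)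
      also have "\<dots> \<le> - \<bar>Z\<bar>"
        using \<Lambda>(2) \<delta>(1) by (simp add: field_simps)
      finally show ?thesis by simp
    qed
    with b show "\<forall>\<^sub>F t in at_right 0. (trans_prob M \<gamma> c \<sigma> T0 T None None t - 1) / t \<le> Z"
      by (auto simp: eventually_at_right_field)
  qed
qed

theorem proposition5p9:
  fixes M :: "'w measure"
    and \<gamma> rate :: "'s::countable \<Rightarrow> real"
    and c :: real
    and \<sigma> :: "'s \<Rightarrow> nat \<Rightarrow> 'w \<Rightarrow> real"
    and T0 :: "'w \<Rightarrow> real"
    and T :: "'s \<Rightarrow> nat \<Rightarrow> 'w \<Rightarrow> real"
  assumes "infinite (UNIV :: 's set)"
    and "prob_space M"
    and "\<And>x. \<gamma> x > 0"
    and "\<And>x. rate x > 0"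
    and "c \<ge> 0"
    and "\<not> rate summable_on UNIV"
    and "(\<lambda>x. rate x * \<gamma> x) summable_on UNIV"
    and "\<And>x. poisson_process M (rate x) (\<sigma> x)"
    and "distributed M lborel T0 (exponential_density 1)"
    and "\<And>x n. n \<ge> 1 \<Longrightarrow> distributed M lborel (T x n) (exponential_density 1)"
    and "independent_inputs M \<sigma> T0 T"
  shows "filterlim (\<lambda>t. (trans_prob M \<gamma> c \<sigma> T0 T None None t - 1) / t) at_bot (at_right 0)"
proof -
  have "K_process_inputs M \<gamma> rate c \<sigma> T0 T"
    by (rule K_process_inputs.intro[OF assms(2) K_process_inputs_axioms.intro[OF assms(3,4,5,8,10,11)]])
  then show ?thesis
    by (rule K_process_inputs.filterlim_trans_prob_infinity[OF _ assms(6,7)])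
qed

end
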